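(* Let $X$ be a finite set with $|X|\ge 2$ and let $G$ be a countable group acting self-similarly on $X^\omega$. Let $\mu$ be the Bernoulli measure on $X^\omega$ and let $(X^\omega)_{G\text{-gen}}$ be the set of $G$-generic points. Then either $\mu\big((X^\omega)_{G\text{-gen}}\big)=1$ or $\mu\big((X^\omega)_{G\text{-gen}}\big)=0$.
   Context: $X^\omega$ is the set of unilateral infinite words over $X$, identified with $X^{\mathbb N}$ with the product topology of the discrete topologies. A faithful action of a group $G$ on $X^\omega$ is self-similar if for every $g\in G$ and $x\in X$ there exist $h\in G$ and $v\in X$ such that $g(xw)=v\,h(w)$ for all $w\in X^\omega$. For $g\in G$, a point $w\in X^\omega$ is $g$-generic if either $g(w)\neq w$ or there is a neighborhood of $w$ consisting of fixed points of $g$; $(X^\omega)_{g\text{-gen}}$ is the set of $g$-generic points and $(X^\omega)_{G\text{-gen}}:=\bigcap_{g\in G}(X^\omega)_{g\text{-gen}}$ is the set of $G$-generic points. The Bernoulli measure $\mu$ is the product probability measure on $X^\omega$ of the uniform probability measures on the finite set $X$. *)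

theory Defs
  imports "HOL-Algebra.Group_Action" "HOL-Probability.Probability"
begin

text \<open>
  The infinite words over an alphabet \<open>X\<close> are the functions from the naturals into \<open>X\<close>; the word
  that starts with the letter \<open>x\<close> and continues with the word \<open>w\<close> is \<open>case_nat x w\<close>.
\<close>

definition words :: "'a set \<Rightarrow> (nat \<Rightarrow> 'a) set"
  where "words X = (\<Pi>\<^sub>E n\<in>UNIV. X)"

definition word_topology :: "'a set \<Rightarrow> (nat \<Rightarrow> 'a) topology"
  where "word_topology X = product_topology (\<lambda>_. discrete_topology X) UNIV"

definition bernoulli_measure :: "'a set \<Rightarrow> (nat \<Rightarrow> 'a) measure"
  where "bernoulli_measure X = (\<Pi>\<^sub>M n\<in>UNIV. uniform_count_measure X)"

lemma topspace_word_topology: "topspace (word_topology X) = words X"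
  by (simp add: word_topology_def words_def)

lemma space_bernoulli_measure: "space (bernoulli_measure X) = words X"
  by (simp add: bernoulli_measure_def words_def space_PiM space_uniform_count_measure)

locale self_similar_action =
  faithful_action G "words X" \<phi>
  for G :: "('g, 'm) monoid_scheme" (structure)
    and X :: "'a set"
    and \<phi> :: "'g \<Rightarrow> (nat \<Rightarrow> 'a) \<Rightarrow> nat \<Rightarrow> 'a" +
  assumes self_similar:
    "\<lbrakk>g \<in> carrier G; x \<in> X\<rbrakk> \<Longrightarrow>
      \<exists>h\<in>carrier G. \<exists>v\<in>X. \<forall>w\<in>words X. \<phi> g (case_nat x w) = case_nat v (\<phi> h w)"

definition generic_points_of ::
    "'a set \<Rightarrow> ('g \<Rightarrow> (nat \<Rightarrow> 'a) \<Rightarrow> nat \<Rightarrow> 'a) \<Rightarrow> 'g \<Rightarrow> (nat \<Rightarrow> 'a) set"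
  where "generic_points_of X \<phi> g =
    {w \<in> words X. \<phi> g w \<noteq> w \<or>
       (\<exists>U. openin (word_topology X) U \<and> w \<in> U \<and> (\<forall>u\<in>U. \<phi> g u = u))}"

definition generic_points ::
    "('g, 'm) monoid_scheme \<Rightarrow> 'a set \<Rightarrow> ('g \<Rightarrow> (nat \<Rightarrow> 'a) \<Rightarrow> nat \<Rightarrow> 'a) \<Rightarrow> (nat \<Rightarrow> 'a) set"
  where "generic_points G X \<phi> = (\<Inter>g\<in>carrier G. generic_points_of X \<phi> g)"

end

theory Submission
  imports Defs
begin

text \<open>
  Cutting off the first letter of a word that is not generic leaves a word that is not generic:
  if \<open>g\<close> fixes \<open>xw\<close> but no neighbourhood of it, then \<open>g(xu) = x h(u)\<close> for some \<open>h\<close> in the group,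
  and \<open>h\<close> fixes \<open>w\<close> but no neighbourhood of it. So the set \<open>A\<close> of generic points satisfies
  \<open>\<sigma>\<^sup>-\<^sup>1(A) \<subseteq> A\<close> for the shift \<open>\<sigma>\<close> (lemma \<open>generic_points_Cons\<close>).

  The Bernoulli measure is invariant under the shift, so the decreasing sets \<open>\<sigma>\<^sup>-\<^sup>n(A)\<close> all have the
  measure of \<open>A\<close>, and so does their intersection. This intersection is unchanged when finitely many
  letters of a word are changed; it is a tail event, and Kolmogorov's zero-one law applies
  to it (lemma \<open>shift_backward_closed_zero_one\<close>).

  Measurability holds because a self-similar transformation determines each letter of the image
  from a finite prefix of the argument. Hence a difference between \<open>g(w)\<close> and \<open>w\<close> at a given
  place is a condition on a finite prefix of \<open>w\<close>, and so is the property that \<open>g\<close> fixes all words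
  with the first \<open>n\<close> letters of \<open>w\<close>. Genericity combines countably many of these conditions,
  because the group is countable.
\<close>

section \<open>A zero-one law for the one-sided shift\<close>

lemma shift_measurable:
  "(\<lambda>w k. w (k + n)) \<in> (\<Pi>\<^sub>M i\<in>(UNIV::nat set). M) \<rightarrow>\<^sub>M (\<Pi>\<^sub>M i\<in>UNIV. M)"
  by (rule measurable_PiM_single') (auto simp: space_PiM PiE_iff)

lemma measure_shift_vimage:
  assumes "prob_space M" and "A \<in> sets (\<Pi>\<^sub>M i\<in>(UNIV::nat set). M)"
  shows "measure (\<Pi>\<^sub>M i\<in>UNIV. M) ((\<lambda>w k. w (k + n)) -` A \<inter> space (\<Pi>\<^sub>M i\<in>UNIV. M)) =
    measure (\<Pi>\<^sub>M i\<in>UNIV. M) A"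
proof -
  have "distr (\<Pi>\<^sub>M i\<in>(UNIV::nat set). M) (\<Pi>\<^sub>M i\<in>(UNIV::nat set). M) (\<lambda>w. \<lambda>k\<in>UNIV. w (k + n)) =
      (\<Pi>\<^sub>M i\<in>UNIV. M)"
    by (rule distr_PiM_reindex) (auto simp: assms(1))
  then have "distr (\<Pi>\<^sub>M i\<in>(UNIV::nat set). M) (\<Pi>\<^sub>M i\<in>(UNIV::nat set). M) (\<lambda>w k. w (k + n)) =
      (\<Pi>\<^sub>M i\<in>UNIV. M)"
    by (simp add: restrict_def)
  then show ?thesis
    using measure_distr[OF shift_measurable assms(2)] by metis
qed

lemma indep_vars_coordinates:
  assumes M: "\<And>i. i \<in> I \<Longrightarrow> prob_space (M i)" and "I \<noteq> {}"
  shows "prob_space.indep_vars (PiM I M) M (\<lambda>i w. w i) I"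
proof -
  interpret P: prob_space "PiM I M"
    by (rule prob_space_PiM) (rule M)
  have "distr (PiM I M) (PiM I M) (\<lambda>w. \<lambda>i\<in>I. w i) = distr (PiM I M) (PiM I M) (\<lambda>w. w)"
    by (rule distr_cong) (auto simp: space_PiM PiE_restrict)
  moreover have "(\<Pi>\<^sub>M i\<in>I. distr (PiM I M) (M i) (\<lambda>w. w i)) = PiM I M"
    by (rule PiM_cong) (auto simp: distr_PiM_component M)
  ultimately show ?thesis
    using P.indep_vars_iff_distr_eq_PiM'[OF assms(2), where M' = M and X = "\<lambda>i w. w i"]
    by (simp add: distr_id2)
qed

text \<open>
  The preimages of \<open>A\<close> under the powers of the shift decrease and all have the measure of \<open>A\<close>, hence
  so does their intersection. The intersection is its own preimage under every power of the shift,
  hence a tail event of the independent coordinates.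
\<close>

lemma shift_backward_closed_zero_one:
  assumes M: "prob_space M"
    and A: "A \<in> sets (\<Pi>\<^sub>M i\<in>(UNIV::nat set). M)"
    and closed: "\<And>w. w \<in> space (\<Pi>\<^sub>M i\<in>(UNIV::nat set). M) \<Longrightarrow> (\<lambda>k. w (Suc k)) \<in> A \<Longrightarrow> w \<in> A"
  shows "measure (\<Pi>\<^sub>M i\<in>UNIV. M) A = 0 \<or> measure (\<Pi>\<^sub>M i\<in>UNIV. M) A = 1"
proof -
  let ?S = "\<Pi>\<^sub>M i\<in>(UNIV::nat set). M"
  interpret P: prob_space ?S
    by (rule prob_space_PiM) (rule M)
  define C where "C n = (\<lambda>w k. w (k + n)) -` A \<inter> space ?S" for n :: nat
  define B where "B = (\<Inter>n. C n)"
  have C_sets: "C n \<in> sets ?S" for n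
    unfolding C_def by (rule measurable_sets[OF shift_measurable A])
  then have B_sets: "B \<in> sets ?S"
    unfolding B_def by auto
  have shift_space: "(\<lambda>k. w (k + n)) \<in> space ?S" if "w \<in> space ?S" for w and n :: nat
    using that by (auto simp: space_PiM)
  have C_Suc: "C (Suc n) \<subseteq> C n" for n
  proof
    fix w assume w: "w \<in> C (Suc n)"
    then have "(\<lambda>k. w (k + n)) \<in> A"
      using closed[of "\<lambda>k. w (k + n)"] shift_space[of w n] by (simp add: C_def)
    with w show "w \<in> C n"
      by (simp add: C_def)
  qed
  then have dec: "decseq C"
    by (rule decseq_SucI)
  have "(\<lambda>n. P.prob (C n)) \<longlonglongrightarrow> P.prob B"
    unfolding B_def using C_sets dec by (intro P.finite_Lim_measure_decseq) auto
  moreover have "P.prob (C n) = P.prob A" for n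
    unfolding C_def by (rule measure_shift_vimage[OF M A])
  ultimately have prob_B: "P.prob A = P.prob B"
    by (simp add: LIMSEQ_const_iff)

  define F where "F i = sigma_sets (space ?S) {(\<lambda>w. w i) -` E \<inter> space ?S |E. E \<in> sets M}" for i :: nat
  have F_Pow: "F i \<subseteq> Pow (space ?S)" for i
    unfolding F_def by (intro sigma_algebra.sigma_sets_subset sigma_algebra_Pow) auto
  have "P.indep_vars (\<lambda>_. M) (\<lambda>i w. w i) UNIV"
    by (rule indep_vars_coordinates) (auto simp: M)
  then have indep: "P.indep_sets F UNIV"
    unfolding P.indep_vars_def F_def by simp
  have F_algebra: "sigma_algebra (space ?S) (F i)" for i
    unfolding F_def by (rule sigma_algebra_sigma_sets) auto
  have "B \<in> sigma_sets (space ?S) (\<Union>(F ` {m..}))" for m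
  proof -
    define T where "T = sigma (space ?S) (\<Union>(F ` {m..}))"
    have T_gen: "\<Union>(F ` {m..}) \<subseteq> Pow (space ?S)"
      using F_Pow by auto
    have space_T: "space T = space ?S"
      and sets_T: "sets T = sigma_sets (space ?S) (\<Union>(F ` {m..}))"
      using T_gen by (simp_all add: T_def)
    have "(\<lambda>w. w (k + m)) \<in> T \<rightarrow>\<^sub>M M" for k
    proof (rule measurableI)
      fix w assume "w \<in> space T"
      then show "w (k + m) \<in> space M"
        by (auto simp: space_T space_PiM)
    next
      fix E assume "E \<in> sets M"
      then have "(\<lambda>w. w (k + m)) -` E \<inter> space ?S \<in> F (k + m)"
        unfolding F_def by blast
      then show "(\<lambda>w. w (k + m)) -` E \<inter> space T \<in> sets T"
        unfolding space_T sets_T by (intro sigma_sets.Basic) auto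
    qed
    then have "(\<lambda>w k. w (k + m)) \<in> T \<rightarrow>\<^sub>M ?S"
      by (intro measurable_PiM_single') (auto simp: space_T space_PiM PiE_iff)
    then have "(\<lambda>w k. w (k + m)) -` B \<inter> space T \<in> sets T"
      using B_sets by (rule measurable_sets)
    \<comment> \<open>As the sets \<open>C n\<close> decrease, dropping the first \<open>m\<close> of them does not change their intersection.\<close>
    moreover have "(\<lambda>w k. w (k + m)) -` B \<inter> space ?S = B"
    proof -
      have "w \<in> B \<longleftrightarrow> (\<lambda>k. w (k + m)) \<in> B" if w: "w \<in> space ?S" for w
      proof -
        have "w \<in> B \<longleftrightarrow> (\<forall>n. w \<in> C (n + m))"
          unfolding B_def using decseqD[OF dec] le_add1 by blast
        also have "\<dots> \<longleftrightarrow> (\<lambda>k. w (k + m)) \<in> B"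
          using w shift_space[OF w, of m] by (simp add: B_def C_def add.assoc)
        finally show ?thesis .
      qed
      moreover have "B \<subseteq> space ?S"
        using B_sets by (rule sets.sets_into_space)
      ultimately show ?thesis
        by auto
    qed
    ultimately show ?thesis
      by (simp add: space_T sets_T)
  qed
  then have "B \<in> P.tail_events F"
    by (simp add: P.tail_events_def)
  then show ?thesis
    using P.kolmogorov_0_1_law[OF F_algebra indep] prob_B by simp
qed

section \<open>Conditions on finite prefixes\<close>

text \<open>A condition on the first \<open>n\<close> letters defines a union of cylinders, one for each of the countably many
  prefixes.\<close>

lemma prefix_determined_measurable:
  assumes "countable X"
    and P: "\<And>u w. u \<in> words X \<Longrightarrow> w \<in> words X \<Longrightarrow> (\<And>i. i < n \<Longrightarrow> u i = w i) \<Longrightarrow> P u \<Longrightarrow> P w"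
  shows "{w \<in> words X. P w} \<in> sets (bernoulli_measure X)"
proof -
  let ?cyl = "\<lambda>l. {w \<in> words X. map w [0..<n] = l}"
  let ?L = "(\<lambda>w. map w [0..<n]) ` {w \<in> words X. P w}"
  have "?L \<subseteq> lists X"
    by (auto simp: words_def PiE_iff)
  then have L: "countable ?L"
    by (rule countable_subset) (simp add: assms(1))
  have "(\<lambda>w. w i) \<in> bernoulli_measure X \<rightarrow>\<^sub>M uniform_count_measure X" for i
    unfolding bernoulli_measure_def by (rule measurable_component_singleton) simp
  then have coord: "{w \<in> words X. w i = x} \<in> sets (bernoulli_measure X)" for i x
  proof -
    assume m: "\<And>i. (\<lambda>w. w i) \<in> bernoulli_measure X \<rightarrow>\<^sub>M uniform_count_measure X"
    have "(\<lambda>w. w i) -` ({x} \<inter> X) \<inter> words X \<in> sets (bernoulli_measure X)"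
      using measurable_sets[OF m[of i], of "{x} \<inter> X"]
      by (simp add: sets_uniform_count_measure space_bernoulli_measure)
    also have "(\<lambda>w. w i) -` ({x} \<inter> X) \<inter> words X = {w \<in> words X. w i = x}"
      by (auto simp: words_def PiE_iff)
    finally show ?thesis .
  qed
  have cyl: "?cyl l \<in> sets (bernoulli_measure X)" if "l \<in> ?L" for l
  proof -
    from that have "length l = n" by auto
    then have "?cyl l = {w \<in> space (bernoulli_measure X). \<forall>i<n. w i = l ! i}"
      by (auto simp: list_eq_iff_nth_eq space_bernoulli_measure)
    also have "\<dots> \<in> sets (bernoulli_measure X)"
      using coord by (intro sets.sets_Collect) (auto simp: space_bernoulli_measure)
    finally show ?thesis .
  qed
  have "{w \<in> words X. P w} = (\<Union>l\<in>?L. ?cyl l)"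
  proof (intro equalityI subsetI)
    fix w assume "w \<in> (\<Union>l\<in>?L. ?cyl l)"
    then obtain u where "u \<in> words X" "P u" "w \<in> words X" and eq: "map w [0..<n] = map u [0..<n]"
      by auto
    then show "w \<in> {w \<in> words X. P w}"
      using P[of u w] by (auto simp: map_eq_conv)
  qed auto
  also have "\<dots> \<in> sets (bernoulli_measure X)"
    using L cyl by (rule sets.countable_UN'')
  finally show ?thesis .
qed

lemma openin_cylinder:
  assumes "w \<in> words X"
  shows "openin (word_topology X) {u \<in> words X. \<forall>i<n. u i = w i}"
proof -
  have "{u \<in> words X. \<forall>i<n. u i = w i} = (\<Pi>\<^sub>E i\<in>UNIV. if i < n then {w i} else X)"
    using assms by (auto simp: words_def PiE_iff split: if_splits)
  also have "openin (word_topology X) \<dots>"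
    unfolding word_topology_def
  proof (subst openin_PiE_gen, intro disjI2 conjI ballI)
    show "finite {i \<in> UNIV. (if i < n then {w i} else X) \<noteq> topspace (discrete_topology X)}"
      by (rule finite_subset[of _ "{..<n}"]) auto
    show "openin (discrete_topology X) (if i < n then {w i} else X)" for i
      using assms by (auto simp: words_def PiE_iff)
  qed
  finally show ?thesis .
qed

lemma open_contains_cylinder:
  assumes "openin (word_topology X) U" and "w \<in> U"
  shows "\<exists>n. {u \<in> words X. \<forall>i<n. u i = w i} \<subseteq> U"
proof -
  from assms obtain V where fin: "finite {i. V i \<noteq> X}"
    and w: "w \<in> Pi\<^sub>E UNIV V" and V: "Pi\<^sub>E UNIV V \<subseteq> U"
    unfolding word_topology_def openin_product_topology_alt by auto
  from fin obtain n where n: "\<And>i. V i \<noteq> X \<Longrightarrow> i < n"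
    unfolding finite_nat_set_iff_bounded by auto
  have "u \<in> Pi\<^sub>E UNIV V" if "u \<in> words X" "\<forall>i<n. u i = w i" for u
  proof -
    have "u i \<in> V i" for i
    proof (cases "V i = X")
      case True
      with that(1) show ?thesis by (auto simp: words_def PiE_iff)
    next
      case False
      then have "u i = w i" using n that(2) by blast
      with w show ?thesis by (auto simp: PiE_iff)
    qed
    then show ?thesis by (simp add: PiE_iff)
  qed
  with V show ?thesis by blast
qed

lemma generic_points_of_iff_cylinder:
  "w \<in> generic_points_of X \<phi> g \<longleftrightarrow>
    w \<in> words X \<and> (\<phi> g w \<noteq> w \<or> (\<exists>n. \<forall>u\<in>words X. (\<forall>i<n. u i = w i) \<longrightarrow> \<phi> g u = u))"
    (is "_ \<longleftrightarrow> _ \<and> (_ \<or> ?R)")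
proof (cases "w \<in> words X")
  case True
  have "(\<exists>U. openin (word_topology X) U \<and> w \<in> U \<and> (\<forall>u\<in>U. \<phi> g u = u)) \<longleftrightarrow> ?R"
  proof
    assume "\<exists>U. openin (word_topology X) U \<and> w \<in> U \<and> (\<forall>u\<in>U. \<phi> g u = u)"
    then obtain U where "openin (word_topology X) U" "w \<in> U" and fixed: "\<forall>u\<in>U. \<phi> g u = u"
      by blast
    from open_contains_cylinder[OF this(1,2)] fixed show ?R
      by blast
  next
    assume ?R
    then obtain n where "\<forall>u\<in>words X. (\<forall>i<n. u i = w i) \<longrightarrow> \<phi> g u = u"
      by blast
    with True openin_cylinder[OF True, of n]
    show "\<exists>U. openin (word_topology X) U \<and> w \<in> U \<and> (\<forall>u\<in>U. \<phi> g u = u)"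
      by (intro exI[of _ "{u \<in> words X. \<forall>i<n. u i = w i}"]) auto
  qed
  with True show ?thesis
    unfolding generic_points_of_def by simp
qed (simp add: generic_points_of_def)

section \<open>Generic points of a self-similar action\<close>

lemma word_Cons_cases:
  assumes "w \<in> words X"
  shows "case_nat (w 0) (\<lambda>k. w (Suc k)) = w" and "w 0 \<in> X" and "(\<lambda>k. w (Suc k)) \<in> words X"
  using assms by (auto simp: words_def PiE_iff fun_eq_iff split: nat.split)

context self_similar_action
begin

text \<open>Self-similarity makes the action one by automorphisms of the tree of finite words: the first letter of
  the image depends on the first letter alone, and the rest is the image of the rest under an element of \<open>G\<close>.\<close>

lemma action_prefix_determined:
  assumes "g \<in> carrier G" "u \<in> words X" "w \<in> words X" "\<And>i. i \<le> n \<Longrightarrow> u i = w i"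
  shows "\<phi> g u n = \<phi> g w n"
  using assms
proof (induction n arbitrary: g u w)
  case (0 g u w)
  obtain h v where h: "\<forall>w'\<in>words X. \<phi> g (case_nat (u 0) w') = case_nat v (\<phi> h w')"
    using self_similar[OF 0(1) word_Cons_cases(2)[OF 0(2)]] by blast
  have "u 0 = w 0" using 0 by simp
  then have "\<phi> g u = case_nat v (\<phi> h (\<lambda>k. u (Suc k)))" "\<phi> g w = case_nat v (\<phi> h (\<lambda>k. w (Suc k)))"
    using bspec[OF h word_Cons_cases(3)[OF 0(2)]] bspec[OF h word_Cons_cases(3)[OF 0(3)]]
      word_Cons_cases(1)[OF 0(2)] word_Cons_cases(1)[OF 0(3)] by simp_all
  then show ?case by simp
next
  case (Suc n g u w)
  obtain h v where hG: "h \<in> carrier G"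
    and h: "\<forall>w'\<in>words X. \<phi> g (case_nat (u 0) w') = case_nat v (\<phi> h w')"
    using self_similar[OF Suc.prems(1) word_Cons_cases(2)[OF Suc.prems(2)]] by blast
  have "u 0 = w 0" using Suc.prems by simp
  then have "\<phi> g u = case_nat v (\<phi> h (\<lambda>k. u (Suc k)))" "\<phi> g w = case_nat v (\<phi> h (\<lambda>k. w (Suc k)))"
    using bspec[OF h word_Cons_cases(3)[OF Suc.prems(2)]]
      bspec[OF h word_Cons_cases(3)[OF Suc.prems(3)]]
      word_Cons_cases(1)[OF Suc.prems(2)] word_Cons_cases(1)[OF Suc.prems(3)] by simp_all
  with Suc.IH[OF hG word_Cons_cases(3)[OF Suc.prems(2)] word_Cons_cases(3)[OF Suc.prems(3)]]
    Suc.prems(4)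
  show ?case by simp
qed

lemma generic_points_of_measurable:
  assumes "countable X" and g: "g \<in> carrier G"
  shows "generic_points_of X \<phi> g \<in> sets (bernoulli_measure X)"
proof -
  let ?fixes_cyl = "\<lambda>n w. \<forall>u\<in>words X. (\<forall>i<n. u i = w i) \<longrightarrow> \<phi> g u = u"
  have "{w \<in> words X. \<phi> g w n \<noteq> w n} \<in> sets (bernoulli_measure X)" for n
    by (rule prefix_determined_measurable[OF assms(1), of "Suc n"])
       (metis action_prefix_determined[OF g] le_imp_less_Suc lessI)
  moreover have "{w \<in> words X. ?fixes_cyl n w} \<in> sets (bernoulli_measure X)" for n
    by (rule prefix_determined_measurable[OF assms(1), of n]) simp
  ultimately have "(\<Union>n. {w \<in> words X. \<phi> g w n \<noteq> w n}) \<union> (\<Union>n. {w \<in> words X. ?fixes_cyl n w})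
      \<in> sets (bernoulli_measure X)"
    by auto
  also have "(\<Union>n. {w \<in> words X. \<phi> g w n \<noteq> w n}) \<union> (\<Union>n. {w \<in> words X. ?fixes_cyl n w}) =
      generic_points_of X \<phi> g"
  proof (rule Set.set_eqI)
    fix w
    have "\<phi> g w \<noteq> w \<longleftrightarrow> (\<exists>n. \<phi> g w n \<noteq> w n)"
      by (simp add: fun_eq_iff)
    then show "w \<in> (\<Union>n. {w \<in> words X. \<phi> g w n \<noteq> w n}) \<union> (\<Union>n. {w \<in> words X. ?fixes_cyl n w}) \<longleftrightarrow>
        w \<in> generic_points_of X \<phi> g"
      unfolding generic_points_of_iff_cylinder by blast
  qed
  finally show ?thesis .
qed

lemma generic_points_measurable:
  assumes "countable X" and "countable (carrier G)"
  shows "generic_points G X \<phi> \<in> sets (bernoulli_measure X)"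
  unfolding generic_points_def
proof (rule sets.countable_INT'[OF assms(2)])
  show "carrier G \<noteq> {}"
    using group_hom by (metis empty_iff group.is_monoid group_hom.axioms(1) monoid.one_closed)
  show "generic_points_of X \<phi> ` carrier G \<subseteq> sets (bernoulli_measure X)"
    using generic_points_of_measurable[OF assms(1)] by blast
qed

text \<open>The section of \<open>g\<close> at the first letter of \<open>w\<close> witnesses at the tail of \<open>w\<close> whatever \<open>g\<close> witnesses at
  \<open>w\<close>; the converse could fail, as an element of \<open>G\<close> need not be a section at a prescribed letter.\<close>

lemma generic_points_Cons:
  assumes w: "w \<in> words X" and gen: "(\<lambda>k. w (Suc k)) \<in> generic_points G X \<phi>"
  shows "w \<in> generic_points G X \<phi>"
  unfolding generic_points_def
proof
  fix g assume g: "g \<in> carrier G"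
  let ?t = "\<lambda>k. w (Suc k)"
  obtain h v where hG: "h \<in> carrier G"
    and h: "\<And>u. u \<in> words X \<Longrightarrow> \<phi> g (case_nat (w 0) u) = case_nat v (\<phi> h u)"
    using self_similar[OF g word_Cons_cases(2)[OF w]] by blast
  have gw: "\<phi> g w = case_nat v (\<phi> h ?t)"
    using h[OF word_Cons_cases(3)[OF w]] word_Cons_cases(1)[OF w] by simp
  show "w \<in> generic_points_of X \<phi> g"
  proof (cases "\<phi> g w = w")
    case True
    have letter: "case_nat v (\<phi> h ?t) i = w i" for i
      unfolding gw[symmetric] True ..
    have v: "v = w 0"
      using letter[of 0] by simp
    have "\<phi> h ?t = ?t"
    proof
      show "\<phi> h ?t k = w (Suc k)" for k
        using letter[of "Suc k"] by simp
    qed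
    moreover have "?t \<in> generic_points_of X \<phi> h"
      using gen hG by (auto simp: generic_points_def)
    ultimately obtain n where n: "\<And>u. u \<in> words X \<Longrightarrow> (\<forall>i<n. u i = ?t i) \<Longrightarrow> \<phi> h u = u"
      unfolding generic_points_of_iff_cylinder by blast
    have "\<phi> g u = u" if u: "u \<in> words X" and eq: "\<forall>i<Suc n. u i = w i" for u
    proof -
      have "\<phi> h (\<lambda>k. u (Suc k)) = (\<lambda>k. u (Suc k))"
        using eq by (intro n word_Cons_cases(3)[OF u]) auto
      moreover have "u 0 = w 0"
        using eq by simp
      ultimately show ?thesis
        using h[OF word_Cons_cases(3)[OF u]] word_Cons_cases(1)[OF u] v by simp
    qed
    with w show ?thesis
      unfolding generic_points_of_iff_cylinder by blast
  qed (simp add: generic_points_of_iff_cylinder w)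
qed

end

theorem theorem2p13:
  fixes G :: "('g, 'm) monoid_scheme"
    and X :: "'a set"
    and \<phi> :: "'g \<Rightarrow> (nat \<Rightarrow> 'a) \<Rightarrow> nat \<Rightarrow> 'a"
  assumes "finite X" and "card X \<ge> 2"
    and "countable (carrier G)"
    and "self_similar_action G X \<phi>"
  shows "generic_points G X \<phi> \<in> sets (bernoulli_measure X) \<and>
    (measure (bernoulli_measure X) (generic_points G X \<phi>) = 1 \<or>
     measure (bernoulli_measure X) (generic_points G X \<phi>) = 0)"
proof -
  interpret self_similar_action G X \<phi>
    by fact
  have prob: "prob_space (uniform_count_measure X)"
    using assms(1,2) by (intro prob_space_uniform_count_measure) auto
  have meas: "generic_points G X \<phi> \<in> sets (bernoulli_measure X)"
    using assms(1,3) by (simp add: generic_points_measurable countable_finite)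
  have "w \<in> generic_points G X \<phi>"
    if "w \<in> space (bernoulli_measure X)" "(\<lambda>k. w (Suc k)) \<in> generic_points G X \<phi>" for w
    using that generic_points_Cons by (simp add: space_bernoulli_measure)
  with shift_backward_closed_zero_one[OF prob, of "generic_points G X \<phi>"] meas
  show ?thesis
    unfolding bernoulli_measure_def by blast
qed

end
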